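(* Let $(\mathbb{R}^{2d+1},\Delta,g)$ be a contact Carnot group with orthonormal frame $X_1,\dots,X_{2d}$, volume $\omega=e^h\mathcal{P}$ ($\mathcal{P}$ the Popp volume, $h\in C^\infty(\mathbb{R}^{2d+1})$) and $c\in(0,1]$. Let $$L_{\omega,c}=\sum_{i=1}^d\sigma_i(c)\left(X_{2i-1}^2+X_{2i}^2\right)+2c\sum_{i=1}^d\sigma_i(c)\left(X_{2i-1}(h)X_{2i-1}+X_{2i}(h)X_{2i}\right)$$ be the limit operator of the geodesic random walk with volume sampling. Let $g'$ be the metric on the same distribution $\Delta$ for which $$X'_{2i-1}=\sqrt{\sigma_i(c)}\,X_{2i-1},\qquad X'_{2i}=\sqrt{\sigma_i(c)}\,X_{2i},\qquad i=1,\dots,d,$$ is a global orthonormal frame, and let $\mathrm{grad}'$ be the horizontal gradient with respect to $g'$. Then $$L_{\omega,c}=\mathrm{div}_\omega\circ\mathrm{grad}'+(2c-1)\,\mathrm{grad}'(h),$$ where $\mathrm{grad}'(h)=\sum_{i=1}^{2d}X_i'(h)X_i'$ is understood as a derivation.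
   Context: Contact Carnot group: $M=\mathbb{R}^{2d+1}$, $d\ge1$, with coordinates $(x,z)\in\mathbb{R}^{2d}\times\mathbb{R}$, and the sub-Riemannian structure with distribution $\Delta$ spanned by, and metric $g$ having as global orthonormal frame, the fields $X_i=\partial_{x_i}-\frac12(Ax)_i\partial_z$, $i=1,\dots,2d$, where $A$ is block diagonal with blocks $\alpha_1J,\dots,\alpha_dJ$, $J=\begin{pmatrix}0&-1\\1&0\end{pmatrix}$, $0<\alpha_1\le\dots\le\alpha_d$. The Popp volume is $\mathcal{P}=\frac{1}{2\sum_{i=1}^d\alpha_i^2}\,dx_1\wedge\dots\wedge dx_{2d}\wedge dz$. The divergence is defined by $\mathcal{L}_X\omega=\mathrm{div}_\omega(X)\,\omega$. The horizontal gradient of $\phi$ with respect to $g'$ is the section of $\Delta$ with $g'(\mathrm{grad}'(\phi),X)=d\phi(X)$ for all sections $X$ of $\Delta$. The constants are $$\sigma_i(c)=\frac{c\,d}{(d+1)\sum_{j=1}^d\int_{-\infty}^{+\infty}|g_j(y)|\,dy}\sum_{\ell=1}^d(1+\delta_{\ell i})\int_{-\infty}^{+\infty}|g_\ell(cp_z)|\,\frac{\sin(\tfrac{\alpha_ip_z}{2})^2}{(\alpha_ip_z/2)^2}\,dp_z,$$ $$g_i(y)=\Big(\prod_{j\ne i}\sin\left(\tfrac{\alpha_jy}{2}\right)\Big)^2\,\frac{\sin\left(\tfrac{\alpha_iy}{2}\right)\left(\tfrac{\alpha_iy}{2}\cos\left(\tfrac{\alpha_iy}{2}\right)-\sin\left(\tfrac{\alpha_iy}{2}\right)\right)}{(y/2)^{2d+2}},$$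 with $\delta_{\ell i}$ the Kronecker delta. *)

theory Defs
  imports "HOL-Analysis.Analysis"
begin

text \<open>For a Euclidean domain, the $C^k$ functions: all iterated directional derivatives of
  order up to \<open>k\<close> exist as Frechet derivatives and are continuous.\<close>

primrec Ck :: "nat \<Rightarrow> ('a::euclidean_space \<Rightarrow> 'b::real_normed_vector) \<Rightarrow> bool" where
  "Ck 0 f \<longleftrightarrow> continuous_on UNIV f"
| "Ck (Suc k) f \<longleftrightarrow>
     (\<forall>p. f differentiable (at p)) \<and> (\<forall>v. Ck k (\<lambda>p. frechet_derivative f (at p) v))"

definition smooth :: "('a::euclidean_space \<Rightarrow> 'b::real_normed_vector) \<Rightarrow> bool" where
  "smooth f \<longleftrightarrow> (\<forall>k. Ck k f)"

text \<open>Every tangent space is identified with the ambient vector space, so a vector field on \<open>'a\<close>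
  is a map \<open>'a \<Rightarrow> 'a\<close>; it acts on functions by \<open>Y(\<phi>) = d\<phi>(Y)\<close>.\<close>

definition derivation ::
  "('a::euclidean_space \<Rightarrow> 'a) \<Rightarrow> ('a \<Rightarrow> real) \<Rightarrow> 'a \<Rightarrow> real" where
  "derivation Y \<phi> p = frechet_derivative \<phi> (at p) (Y p)"

definition lie_bracket ::
  "('a::euclidean_space \<Rightarrow> 'a) \<Rightarrow> ('a \<Rightarrow> 'a) \<Rightarrow> 'a \<Rightarrow> 'a" where
  "lie_bracket X Y p =
     frechet_derivative Y (at p) (X p) - frechet_derivative X (at p) (Y p)"

text \<open>A form of top degree on \<open>real ^ 'n\<close> takes a base point and a tuple of tangent vectors; the
  tuple \<open>v\<close> has entries \<open>v $ i\<close>, indexed by \<open>'n\<close>, so that the coordinate volume form is \<open>det v\<close>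
  (which does not depend on an ordering of \<open>'n\<close>).\<close>

type_synonym 'n top_form = "real ^ 'n \<Rightarrow> real ^ 'n ^ 'n \<Rightarrow> real"

text \<open>This is the formula
  $(L_X \omega)(V_1,\dots,V_n) = X(\omega(V_1,\dots,V_n))
    - \sum_i \omega(V_1,\dots,[X,V_i],\dots,V_n)$,
  in which the tangent vectors \<open>v $ i\<close> at \<open>p\<close> are extended to constant vector fields; the result
  does not depend on the extension because the Lie derivative is tensorial.\<close>

definition lie_derivative ::
  "(real ^ 'n \<Rightarrow> real ^ 'n) \<Rightarrow> 'n::finite top_form \<Rightarrow> 'n top_form" where
  "lie_derivative X \<omega> p v =
     derivation X (\<lambda>q. \<omega> q v) p -
     (\<Sum>i\<in>UNIV. \<omega> p (\<chi> j. if j = i then lie_bracket X (\<lambda>_. v $ i) p else v $ j))"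

definition divergence ::
  "'n::finite top_form \<Rightarrow> (real ^ 'n \<Rightarrow> real ^ 'n) \<Rightarrow> real ^ 'n \<Rightarrow> real" where
  "divergence \<omega> X = (THE f. \<forall>p v. lie_derivative X \<omega> p v = f p * \<omega> p v)"

definition horizontal_section ::
  "('a::euclidean_space \<Rightarrow> 'a set) \<Rightarrow> ('a \<Rightarrow> 'a) \<Rightarrow> bool" where
  "horizontal_section D Y \<longleftrightarrow> smooth Y \<and> (\<forall>p. Y p \<in> D p)"

text \<open>The values of \<open>g p\<close> outside \<open>D p\<close> are irrelevant.\<close>

definition sub_riemannian_metric ::
  "('a::euclidean_space \<Rightarrow> 'a set) \<Rightarrow> ('a \<Rightarrow> 'a \<Rightarrow> 'a \<Rightarrow> real) \<Rightarrow> bool" where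
  "sub_riemannian_metric D g \<longleftrightarrow>
     (\<forall>p. \<forall>u\<in>D p. \<forall>v\<in>D p. g p u v = g p v u) \<and>
     (\<forall>p. \<forall>u\<in>D p. \<forall>v\<in>D p. \<forall>w\<in>D p. g p (u + v) w = g p u w + g p v w) \<and>
     (\<forall>p r. \<forall>u\<in>D p. \<forall>v\<in>D p. g p (r *\<^sub>R u) v = r * g p u v) \<and>
     (\<forall>p. \<forall>u\<in>D p. u \<noteq> 0 \<longrightarrow> 0 < g p u u) \<and>
     (\<forall>Y Z. horizontal_section D Y \<longrightarrow> horizontal_section D Z \<longrightarrow>
        smooth (\<lambda>p. g p (Y p) (Z p)))"

definition orthonormal_frame ::
  "('a::euclidean_space \<Rightarrow> 'a set) \<Rightarrow> ('a \<Rightarrow> 'a \<Rightarrow> 'a \<Rightarrow> real) \<Rightarrow> ('i \<Rightarrow> 'a \<Rightarrow> 'a) \<Rightarrow> bool" where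
  "orthonormal_frame D g X \<longleftrightarrow>
     (\<forall>a. horizontal_section D (X a)) \<and>
     (\<forall>p. D p = span (range (\<lambda>a. X a p))) \<and>
     (\<forall>p a b. g p (X a p) (X b p) = (if a = b then 1 else 0))"

definition horizontal_gradient ::
  "('a::euclidean_space \<Rightarrow> 'a set) \<Rightarrow> ('a \<Rightarrow> 'a \<Rightarrow> 'a \<Rightarrow> real) \<Rightarrow> ('a \<Rightarrow> real) \<Rightarrow> 'a \<Rightarrow> 'a" where
  "horizontal_gradient D g \<phi> =
     (THE Y. horizontal_section D Y \<and>
        (\<forall>Z. horizontal_section D Z \<longrightarrow> (\<forall>p. g p (Y p) (Z p) = derivation Z \<phi> p)))"

text \<open>The type \<open>'d\<close> indexes the blocks, with $d$ = \<open>CARD('d)\<close>, and its linear order is that of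
  the indices $1 < \dots < d$. The horizontal coordinate $x_{2i-1}$ is indexed by \<open>(i, 1)\<close> and
  $x_{2i}$ by \<open>(i, 2)\<close>; \<open>Some\<close> embeds the horizontal indices into the coordinate indices of
  $\mathbb{R}^{2d+1}$, and \<open>None\<close> is the index of the coordinate $z$.\<close>

type_synonym 'd hor = "'d \<times> 2"
type_synonym 'd pt = "real ^ ('d hor option)"

definition J :: "real ^ 2 ^ 2" where
  "J = vector [vector [0, -1], vector [1, 0]]"

definition A_mat :: "('d::finite \<Rightarrow> real) \<Rightarrow> real ^ 'd hor ^ 'd hor" where
  "A_mat \<alpha> = (\<chi> a b. if fst a = fst b then \<alpha> (fst a) * J $ snd a $ snd b else 0)"

definition hor_part :: "'d::finite pt \<Rightarrow> real ^ 'd hor" where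
  "hor_part p = (\<chi> a. p $ Some a)"

definition frame :: "('d::finite \<Rightarrow> real) \<Rightarrow> 'd hor \<Rightarrow> 'd pt \<Rightarrow> 'd pt" where
  "frame \<alpha> a p =
     axis (Some a) 1 - ((1/2) * (A_mat \<alpha> *v hor_part p) $ a) *\<^sub>R axis None 1"

definition contact_carnot_group ::
  "('d::{finite,linorder} \<Rightarrow> real) \<Rightarrow> ('d pt \<Rightarrow> 'd pt set) \<Rightarrow>
   ('d pt \<Rightarrow> 'd pt \<Rightarrow> 'd pt \<Rightarrow> real) \<Rightarrow> bool" where
  "contact_carnot_group \<alpha> \<Delta> g \<longleftrightarrow>
     (\<forall>i. 0 < \<alpha> i) \<and> mono \<alpha> \<and>
     (\<forall>p. \<Delta> p = span (range (\<lambda>a. frame \<alpha> a p))) \<and>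
     sub_riemannian_metric \<Delta> g \<and> orthonormal_frame \<Delta> g (frame \<alpha>)"

definition popp_volume :: "('d::finite \<Rightarrow> real) \<Rightarrow> ('d hor option) top_form" where
  "popp_volume \<alpha> p v = 1 / (2 * (\<Sum>i\<in>UNIV. (\<alpha> i)\<^sup>2)) * det v"

definition weighted_volume ::
  "('d::finite \<Rightarrow> real) \<Rightarrow> ('d pt \<Rightarrow> real) \<Rightarrow> ('d hor option) top_form" where
  "weighted_volume \<alpha> h p v = exp (h p) * popp_volume \<alpha> p v"

text \<open>The integrands below are of the form \<open>0/0\<close> at the origin; the value there (0 by the
  convention \<open>x / 0 = 0\<close>) does not affect the integrals.\<close>

definition g_fun :: "('d::finite \<Rightarrow> real) \<Rightarrow> 'd \<Rightarrow> real \<Rightarrow> real" where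
  "g_fun \<alpha> i y =
     (\<Prod>j\<in>UNIV - {i}. sin (\<alpha> j * y / 2))\<^sup>2 *
     (sin (\<alpha> i * y / 2) * (\<alpha> i * y / 2 * cos (\<alpha> i * y / 2) - sin (\<alpha> i * y / 2))
       / (y / 2) ^ (2 * CARD('d) + 2))"

definition sigma_coeff :: "('d::finite \<Rightarrow> real) \<Rightarrow> real \<Rightarrow> 'd \<Rightarrow> real" where
  "sigma_coeff \<alpha> c i =
     c * real CARD('d) /
       ((real CARD('d) + 1) * (\<Sum>j\<in>UNIV. \<integral>y. \<bar>g_fun \<alpha> j y\<bar> \<partial>lborel)) *
     (\<Sum>l\<in>UNIV. (1 + (if l = i then 1 else 0)) *
        (\<integral>y. \<bar>g_fun \<alpha> l (c * y)\<bar> * ((sin (\<alpha> i * y / 2))\<^sup>2 / (\<alpha> i * y / 2)\<^sup>2) \<partial>lborel))"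

definition limit_operator ::
  "('d::finite \<Rightarrow> real) \<Rightarrow> ('d pt \<Rightarrow> real) \<Rightarrow> real \<Rightarrow> ('d pt \<Rightarrow> real) \<Rightarrow> 'd pt \<Rightarrow> real" where
  "limit_operator \<alpha> h c \<phi> p =
     (let X = (\<lambda>a. derivation (frame \<alpha> a)) in
       (\<Sum>i\<in>UNIV. sigma_coeff \<alpha> c i *
          (X (i, 1) (X (i, 1) \<phi>) p + X (i, 2) (X (i, 2) \<phi>) p)) +
       2 * c * (\<Sum>i\<in>UNIV. sigma_coeff \<alpha> c i *
          (X (i, 1) h p * X (i, 1) \<phi> p + X (i, 2) h p * X (i, 2) \<phi> p)))"

definition scaled_frame ::
  "('d::finite \<Rightarrow> real) \<Rightarrow> real \<Rightarrow> 'd hor \<Rightarrow> 'd pt \<Rightarrow> 'd pt" where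
  "scaled_frame \<alpha> c a p = sqrt (sigma_coeff \<alpha> c (fst a)) *\<^sub>R frame \<alpha> a p"

end

theory Submission
  imports Defs
begin

text \<open>Testing against an orthonormal frame \<open>X'\<close> forces
  $\mathrm{grad}'(\phi) = \sum_a X'_a(\phi) X'_a$. For a density $e^h$ with respect to Lebesgue
  measure, $\mathrm{div}_\omega(Y) = Y(h) + \mathrm{tr}(DY)$, and the fields $X'_a$ have trace zero
  because $A$ does not involve $z$. Hence
  $\mathrm{div}_\omega(\mathrm{grad}'(\phi)) = \sum_a X'_a(X'_a(\phi)) + X'_a(h) X'_a(\phi)$, where
  $X'_a X'_a = \sigma X_a X_a$ as $\sigma \ge 0$; the remaining $2c - 1$ copies of
  $X'_a(h) X'_a(\phi)$ are $\mathrm{grad}'(h)(\phi)$.\<close>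

section \<open>Smooth functions\<close>

lemma has_frechet_derivative:
  "f differentiable (at p) \<Longrightarrow> (f has_derivative frechet_derivative f (at p)) (at p)"
  by (simp add: frechet_derivative_works)

lemma Ck_Suc_imp_Ck: "Ck (Suc k) f \<Longrightarrow> Ck k f"
proof (induction k arbitrary: f)
  case 0
  then show ?case
    by (auto intro!: differentiable_imp_continuous_on simp: differentiable_on_def)
next
  case (Suc k)
  then show ?case by (metis Ck.simps(2))
qed

lemma Ck_const: "Ck k (\<lambda>_. b)"
  by (induction k arbitrary: b) auto

lemma Ck_add:
  assumes "Ck k f" "Ck k f'"
  shows "Ck k (\<lambda>p. f p + f' p)"
  using assms
proof (induction k arbitrary: f f')
  case 0
  then show ?case by (auto intro: continuous_on_add)
next
  case (Suc k)
  then have "frechet_derivative (\<lambda>p. f p + f' p) (at p) =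
      (\<lambda>v. frechet_derivative f (at p) v + frechet_derivative f' (at p) v)" for p
    by (intro frechet_derivative_at[symmetric] has_derivative_add has_frechet_derivative) auto
  with Suc show ?case by auto
qed

lemma Ck_scaleR:
  fixes f :: "'a::euclidean_space \<Rightarrow> real" and f' :: "'a \<Rightarrow> 'b::real_normed_vector"
  assumes "Ck k f" "Ck k f'"
  shows "Ck k (\<lambda>p. f p *\<^sub>R f' p)"
  using assms
proof (induction k arbitrary: f f')
  case 0
  then show ?case by (auto intro: continuous_on_scaleR)
next
  case (Suc k)
  then have "frechet_derivative (\<lambda>p. f p *\<^sub>R f' p) (at p) =
      (\<lambda>v. f p *\<^sub>R frechet_derivative f' (at p) v + frechet_derivative f (at p) v *\<^sub>R f' p)" for p
    by (intro frechet_derivative_at[symmetric] has_derivative_scaleR has_frechet_derivative) auto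
  \<comment> \<open>The product rule leaves one factor undifferentiated in each term. That factor is
    of class \<open>Suc k\<close> and is lowered to \<open>k\<close>, so that the induction
    hypothesis covers both products.\<close>
  moreover have "Ck k (\<lambda>p. f p *\<^sub>R frechet_derivative f' (at p) v +
      frechet_derivative f (at p) v *\<^sub>R f' p)" for v
    using Suc by (intro Ck_add Suc.IH Ck_Suc_imp_Ck[OF Suc.prems(1)] Ck_Suc_imp_Ck[OF Suc.prems(2)]) auto
  moreover have "(\<lambda>p. f p *\<^sub>R f' p) differentiable (at p)" for p
    using Suc.prems by (intro differentiable_scaleR) auto
  ultimately show ?case by simp
qed

lemma Ck_bounded_linear:
  assumes "bounded_linear L" "Ck k f"
  shows "Ck k (\<lambda>p. L (f p))"
  using assms(2)
proof (induction k arbitrary: f)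
  case 0
  then show ?case by (auto intro: bounded_linear.continuous_on[OF assms(1)])
next
  case (Suc k)
  then have D: "((\<lambda>p. L (f p)) has_derivative (\<lambda>v. L (frechet_derivative f (at p) v))) (at p)" for p
    by (intro bounded_linear.has_derivative[OF assms(1)] has_frechet_derivative) auto
  with Suc show ?case
    by (auto simp: frechet_derivative_at[OF D, symmetric] intro: differentiableI)
qed

lemma smooth_differentiable: "smooth f \<Longrightarrow> f differentiable (at p)"
  unfolding smooth_def by (metis Ck.simps(2))

lemma smooth_frechet_derivative: "smooth f \<Longrightarrow> smooth (\<lambda>p. frechet_derivative f (at p) v)"
  unfolding smooth_def by (metis Ck.simps(2))

lemma smooth_scaleR: "smooth f \<Longrightarrow> smooth f' \<Longrightarrow> smooth (\<lambda>p. f p *\<^sub>R f' p)"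
  by (simp add: smooth_def Ck_scaleR)

lemma smooth_bounded_linear: "bounded_linear L \<Longrightarrow> smooth f \<Longrightarrow> smooth (\<lambda>p. L (f p))"
  by (simp add: smooth_def Ck_bounded_linear)

lemma smooth_sum: "(\<And>a. a \<in> S \<Longrightarrow> smooth (f a)) \<Longrightarrow> smooth (\<lambda>p. \<Sum>a\<in>S. f a p)"
  by (induction S rule: infinite_finite_induct) (auto simp: smooth_def Ck_const Ck_add)

text \<open>The definition of \<open>smooth\<close> controls the derivative of \<open>\<phi>\<close>
  only in a fixed direction, while \<open>Y p\<close> varies with \<open>p\<close>. Expanding
  \<open>Y p\<close> in the standard basis leaves fixed directions with smooth coefficients.\<close>

lemma smooth_derivation:
  assumes "smooth Y" "smooth \<phi>"
  shows "smooth (derivation Y \<phi>)"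
proof -
  have "derivation Y \<phi> p = (\<Sum>b\<in>Basis. (Y p \<bullet> b) *\<^sub>R frechet_derivative \<phi> (at p) b)" for p
  proof -
    have "linear (frechet_derivative \<phi> (at p))"
      using assms by (intro linear_frechet_derivative smooth_differentiable)
    then show ?thesis
      unfolding derivation_def
      by (subst euclidean_representation[of "Y p", symmetric]) (simp add: linear_sum linear_scale)
  qed
  moreover have "smooth (\<lambda>p. \<Sum>b\<in>Basis. (Y p \<bullet> b) *\<^sub>R frechet_derivative \<phi> (at p) b)"
    by (intro smooth_sum smooth_scaleR smooth_frechet_derivative assms
          smooth_bounded_linear[OF bounded_linear_inner_left])
  ultimately show ?thesis by presburger
qed

section \<open>Linearity of derivations\<close>

lemma derivation_scaleR_left:
  "\<phi> differentiable (at p) \<Longrightarrow> derivation (\<lambda>q. f q *\<^sub>R Y q) \<phi> p = f p * derivation Y \<phi> p"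
  by (simp add: derivation_def linear_scale[OF linear_frechet_derivative])

lemma derivation_sum_left:
  "\<phi> differentiable (at p) \<Longrightarrow> derivation (\<lambda>q. \<Sum>a\<in>S. Y a q) \<phi> p = (\<Sum>a\<in>S. derivation (Y a) \<phi> p)"
  by (simp add: derivation_def linear_sum[OF linear_frechet_derivative])

lemma derivation_mult_const:
  assumes "f differentiable (at p)"
  shows "derivation Y (\<lambda>q. r * f q) p = r * derivation Y f p"
  unfolding derivation_def
  by (simp flip: frechet_derivative_at[OF has_derivative_mult_right[OF has_frechet_derivative[OF assms], of r]])

section \<open>The horizontal gradient in an orthonormal frame\<close>

text \<open>The \<open>THE\<close> in the definition of the gradient calls for existence and
  uniqueness. Both come from the expansion of a horizontal vector in the orthonormal frame: applied
  to the test section it verifies the candidate, applied to a given solution it determines the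
  coefficients.\<close>

lemma horizontal_gradient_eq:
  fixes X :: "'i::finite \<Rightarrow> 'a::euclidean_space \<Rightarrow> 'a"
  assumes "sub_riemannian_metric D g" "orthonormal_frame D g X" "smooth \<phi>"
  shows "horizontal_gradient D g \<phi> = (\<lambda>p. \<Sum>a\<in>UNIV. derivation (X a) \<phi> p *\<^sub>R X a p)"
proof -
  have D: "D p = span (range (\<lambda>a. X a p))"
    and hX: "horizontal_section D (X a)"
    and orth: "g p (X a p) (X b p) = (if a = b then 1 else 0)" for p a b
    using assms(2) by (auto simp: orthonormal_frame_def)
  have XD: "X a p \<in> D p" for a p
    using hX by (simp add: horizontal_section_def)
  have sub: "subspace (D p)" for p by (simp add: D)
  have sym: "u \<in> D p \<Longrightarrow> v \<in> D p \<Longrightarrow> g p u v = g p v u"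
    and add: "u \<in> D p \<Longrightarrow> v \<in> D p \<Longrightarrow> w \<in> D p \<Longrightarrow> g p (u + v) w = g p u w + g p v w"
    and scale: "u \<in> D p \<Longrightarrow> v \<in> D p \<Longrightarrow> g p (r *\<^sub>R u) v = r * g p u v" for p u v w r
    using assms(1) unfolding sub_riemannian_metric_def by blast+
  have zero: "g p 0 v = 0" if "v \<in> D p" for p v
    using scale[OF that that, of 0] by simp
  \<comment> \<open>\<open>g p\<close> is linear only on \<open>D p\<close>, so each step of the
    induction must check that the partial sums stay in this subspace.\<close>
  have sum: "g p (\<Sum>a\<in>S. f a *\<^sub>R X a p) v = (\<Sum>a\<in>S. f a * g p (X a p) v)"
    if "v \<in> D p" for p v S and f :: "'i \<Rightarrow> real"
  proof (induction S rule: infinite_finite_induct)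
    case (insert a S)
    have "g p (f a *\<^sub>R X a p + (\<Sum>a\<in>S. f a *\<^sub>R X a p)) v =
        g p (f a *\<^sub>R X a p) v + g p (\<Sum>a\<in>S. f a *\<^sub>R X a p) v"
      by (intro add that subspace_sum subspace_scale sub XD)
    with insert show ?case by (simp add: scale that XD)
  qed (simp_all add: zero that)
  have expand: "u = (\<Sum>a\<in>UNIV. g p u (X a p) *\<^sub>R X a p)" if u: "u \<in> D p" for p u
  proof -
    obtain f where f: "u = (\<Sum>a\<in>UNIV. f a *\<^sub>R X a p)"
    proof -
      have "\<exists>f. u = (\<Sum>a\<in>UNIV. f a *\<^sub>R X a p)"
        using u unfolding D
      proof (induction rule: span_induct_alt)
        case base
        show ?case by (rule exI[of _ "\<lambda>_. 0"]) simp
      next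
        case (step r x y)
        then obtain b f where "x = X b p" "y = (\<Sum>a\<in>UNIV. f a *\<^sub>R X a p)" by blast
        then have "r *\<^sub>R x + y = (\<Sum>a\<in>UNIV. ((if a = b then r else 0) + f a) *\<^sub>R X a p)"
          by (simp add: scaleR_add_left sum.distrib if_distrib[of "\<lambda>t. t *\<^sub>R _"] cong: if_cong)
        then show ?case by (rule exI[of _ "\<lambda>a. (if a = b then r else 0) + f a"])
      qed
      with that show ?thesis by blast
    qed
    \<comment> \<open>Orthonormality recovers the coefficients of any representation of
      \<open>u\<close> by the spanning frame.\<close>
    have "g p u (X b p) = f b" for b
      unfolding f by (simp add: sum XD orth if_distrib cong: if_cong)
    with f show ?thesis by simp
  qed
  let ?G = "\<lambda>p. \<Sum>a\<in>UNIV. derivation (X a) \<phi> p *\<^sub>R X a p"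
  show ?thesis
    unfolding horizontal_gradient_def
  proof (rule the_equality, intro conjI allI impI)
    have "smooth ?G"
      using hX assms(3) by (intro smooth_sum smooth_scaleR smooth_derivation) (auto simp: horizontal_section_def)
    then show "horizontal_section D ?G"
      by (auto simp: horizontal_section_def intro!: subspace_sum subspace_scale sub XD)
  next
    fix Z p assume "horizontal_section D Z"
    then have Z: "Z p \<in> D p" by (simp add: horizontal_section_def)
    have "derivation Z \<phi> p = frechet_derivative \<phi> (at p) (\<Sum>a\<in>UNIV. g p (Z p) (X a p) *\<^sub>R X a p)"
      unfolding derivation_def by (subst expand[OF Z]) simp
    also have "\<dots> = (\<Sum>a\<in>UNIV. g p (Z p) (X a p) * derivation (X a) \<phi> p)"
      using linear_frechet_derivative[OF smooth_differentiable[OF assms(3)]]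
      by (simp add: derivation_def linear_sum linear_scale)
    also have "\<dots> = g p (?G p) (Z p)"
      by (simp add: sum Z sym[OF Z XD] mult.commute)
    finally show "g p (?G p) (Z p) = derivation Z \<phi> p" ..
  next
    fix Y
    assume Y: "horizontal_section D Y \<and>
      (\<forall>Z. horizontal_section D Z \<longrightarrow> (\<forall>p. g p (Y p) (Z p) = derivation Z \<phi> p))"
    show "Y = ?G"
    proof
      fix p
      have "Y p \<in> D p" using Y by (simp add: horizontal_section_def)
      \<comment> \<open>The frame fields are themselves horizontal sections; taking them as
        \<open>Z\<close> gives every coefficient of \<open>Y p\<close>.\<close>
      from expand[OF this] show "Y p = ?G p" using Y hX by simp
    qed
  qed
qed

section \<open>The divergence of a weighted volume\<close>

text \<open>In the Leibniz expansion, the summand of \<open>\<pi>\<close> with row \<open>i\<close> replaced is the one with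
  column \<open>\<pi> i\<close> replaced.\<close>

lemma sum_det_replace_row_eq_column:
  fixes A B :: "'a::comm_ring_1 ^ 'n ^ 'n::finite"
  shows "(\<Sum>i\<in>UNIV. det (\<chi> j. if j = i then B $ j else A $ j)) =
         (\<Sum>k\<in>UNIV. det (\<chi> i j. if j = k then B $ i $ j else A $ i $ j))"
proof -
  have "(\<Sum>i\<in>UNIV. \<Prod>j\<in>UNIV. (if j = i then B $ j else A $ j) $ \<pi> j) =
        (\<Sum>k\<in>UNIV. \<Prod>j\<in>UNIV. if \<pi> j = k then B $ j $ \<pi> j else A $ j $ \<pi> j)"
    if "\<pi> permutes UNIV" for \<pi> :: "'n \<Rightarrow> 'n"
  proof -
    have "bij \<pi>" using that by (rule permutes_bij)
    then have "\<pi> j = \<pi> i \<longleftrightarrow> j = i" for i j by (auto dest: bij_is_inj injD)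
    with sum.reindex_bij_betw[OF \<open>bij \<pi>\<close>,
        of "\<lambda>k. \<Prod>j\<in>UNIV. if \<pi> j = k then B $ j $ \<pi> j else A $ j $ \<pi> j"]
    show ?thesis by (simp add: if_distrib[of "\<lambda>r. r $ _"] cong: if_cong)
  qed
  then show ?thesis
    unfolding det_def
    by (subst (1 2) sum.swap) (auto simp: sum_distrib_left[symmetric] intro!: sum.cong)
qed

text \<open>The infinitesimal form of multiplicativity of the determinant. After passing from rows
  to columns, the new column \<open>k\<close> is the combination of the columns of \<open>v\<close>
  with coefficients \<open>M $ k\<close>, so Cramer's lemma gives the summand
  \<open>M $ k $ k * det v\<close>.\<close>

lemma sum_det_replace_row_linear:
  fixes M :: "real ^ 'n ^ 'n::finite" and v :: "real ^ 'n ^ 'n"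
  shows "(\<Sum>i\<in>UNIV. det (\<chi> j. if j = i then M *v v $ i else v $ j)) = trace M * det v"
proof -
  have "(\<Sum>i\<in>UNIV. det (\<chi> j. if j = i then M *v v $ i else v $ j)) =
      (\<Sum>i\<in>UNIV. det (\<chi> j. if j = i then (\<chi> l. M *v v $ l) $ j else v $ j))"
    by (intro sum.cong refl arg_cong[where f = det]) (auto simp: vec_eq_iff)
  also have "\<dots> = (\<Sum>k\<in>UNIV. det (\<chi> i j. if j = k then (v *v M $ k) $ i else v $ i $ j))"
    unfolding sum_det_replace_row_eq_column
    by (intro sum.cong refl arg_cong[where f = det])
       (auto simp: vec_eq_iff matrix_vector_mult_def mult.commute)
  also have "\<dots> = trace M * det v"
    by (simp add: cramer_lemma trace_def sum_distrib_right)
  finally show ?thesis .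
qed

text \<open>Differentiating the density gives the term \<open>derivation X h\<close>. The brackets
  with constant fields contribute the trace, their minus sign cancelling the one in the Lie
  derivative.\<close>

lemma divergence_density:
  fixes X :: "real ^ 'n \<Rightarrow> real ^ 'n::finite"
  assumes X: "\<And>p. X differentiable (at p)" and h: "\<And>p. h differentiable (at p)" and "K \<noteq> 0"
  shows "divergence (\<lambda>p v. exp (h p) * (K * det v)) X =
    (\<lambda>p. derivation X h p + trace (matrix (frechet_derivative X (at p))))"
proof -
  let ?f = "\<lambda>p. derivation X h p + trace (matrix (frechet_derivative X (at p)))"
  have L: "lie_derivative X (\<lambda>p v. exp (h p) * (K * det v)) p v = ?f p * (exp (h p) * (K * det v))" for p v
  proof -
    define M where "M = matrix (frechet_derivative X (at p))"
    have M: "frechet_derivative X (at p) u = M *v u" for u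
      unfolding M_def using linear_frechet_derivative[OF X] by (simp add: matrix_works)
    \<comment> \<open>A constant field has derivative zero, which leaves only the second term of the
      bracket.\<close>
    have "lie_bracket X (\<lambda>_. u) p = - (M *v u)" for u
      by (simp add: lie_bracket_def M)
    moreover have "det (\<chi> j. if j = i then - (M *v v $ i) else v $ j) =
        - det (\<chi> j. if j = i then M *v v $ i else v $ j)" for i
      using det_row_mul[of i "-1" "\<lambda>_. M *v v $ i" "\<lambda>j. v $ j"]
      by (simp only: vector_sneg_minus1[symmetric] mult_minus1)
    moreover have "derivation X (\<lambda>q. exp (h q) * (K * det v)) p =
        exp (h p) * derivation X h p * (K * det v)"
    proof -
      have "((\<lambda>q. exp (h q) * (K * det v)) has_derivative
          (\<lambda>u. exp (h p) * frechet_derivative h (at p) u * (K * det v))) (at p)"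
        by (auto intro!: derivative_eq_intros has_frechet_derivative[OF h])
      from frechet_derivative_at[OF this] show ?thesis
        unfolding derivation_def by metis
    qed
    ultimately show ?thesis
      unfolding lie_derivative_def
      by (simp add: sum_negf sum_distrib_left[symmetric] sum_det_replace_row_linear
          algebra_simps cong: if_cong flip: M_def)
  qed
  show ?thesis
    unfolding divergence_def
  proof (rule the_equality)
    fix f assume f: "\<forall>p v. lie_derivative X (\<lambda>p v. exp (h p) * (K * det v)) p v =
      f p * (exp (h p) * (K * det v))"
    show "f = ?f"
    proof
      fix p
      \<comment> \<open>On the identity matrix the volume form has the nonzero value
        \<open>exp (h p) * K\<close>, which can be cancelled.\<close>
      show "f p = ?f p"
        using f L[of p "mat 1"] \<open>K \<noteq> 0\<close> by simp
    qed
  qed (use L in simp)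
qed

section \<open>Traces of derivatives of vector fields\<close>

lemma trace_matrix: "trace (matrix f) = (\<Sum>k\<in>UNIV. f (axis k 1) $ k)"
  by (simp add: trace_def matrix_def)

text \<open>The Leibniz rule for the Euclidean divergence: the rank-one part of the derivative,
  sending \<open>v\<close> to \<open>df(v) X\<close>, has trace \<open>df(X)\<close>.\<close>

lemma trace_derivative_scaleR:
  fixes X :: "real ^ 'n \<Rightarrow> real ^ 'n::finite"
  assumes "f differentiable (at p)" "X differentiable (at p)"
  shows "trace (matrix (frechet_derivative (\<lambda>q. f q *\<^sub>R X q) (at p))) =
    derivation X f p + f p * trace (matrix (frechet_derivative X (at p)))"
proof -
  have "frechet_derivative (\<lambda>q. f q *\<^sub>R X q) (at p) =
      (\<lambda>v. f p *\<^sub>R frechet_derivative X (at p) v + frechet_derivative f (at p) v *\<^sub>R X p)"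
    using assms by (intro frechet_derivative_at[symmetric] has_derivative_scaleR has_frechet_derivative)
  moreover have "derivation X f p = (\<Sum>k\<in>UNIV. frechet_derivative f (at p) (axis k 1) * X p $ k)"
    unfolding derivation_def
    by (subst basis_expansion[of "X p", symmetric])
       (simp add: linear_sum[OF linear_frechet_derivative[OF assms(1)]] scalar_mult_eq_scaleR
          linear_scale[OF linear_frechet_derivative[OF assms(1)]] mult.commute)
  ultimately show ?thesis
    by (simp add: trace_matrix sum.distrib sum_distrib_left)
qed

lemma trace_derivative_sum:
  fixes X :: "'i \<Rightarrow> real ^ 'n \<Rightarrow> real ^ 'n::finite"
  assumes "\<And>a. a \<in> S \<Longrightarrow> X a differentiable (at p)"
  shows "trace (matrix (frechet_derivative (\<lambda>q. \<Sum>a\<in>S. X a q) (at p))) =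
    (\<Sum>a\<in>S. trace (matrix (frechet_derivative (X a) (at p))))"
proof -
  have "frechet_derivative (\<lambda>q. \<Sum>a\<in>S. X a q) (at p) = (\<lambda>v. \<Sum>a\<in>S. frechet_derivative (X a) (at p) v)"
    using assms by (intro frechet_derivative_at[symmetric] has_derivative_sum has_frechet_derivative)
  then show ?thesis
    by (simp add: trace_matrix) (rule sum.swap)
qed

text \<open>Each frame field is a constant vector minus a linear map, so its derivative is the same
  at every point.\<close>

lemma frame_has_derivative:
  "(frame \<alpha> a has_derivative (\<lambda>v. - ((1/2) * (A_mat \<alpha> *v hor_part v) $ a) *\<^sub>R axis None 1)) (at p)"
proof -
  have hor_part: "hor_part (u + v) = hor_part u + hor_part v" "hor_part (r *\<^sub>R v) = r *\<^sub>R hor_part v"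
    for u v :: "'a pt" and r
    by (simp_all add: hor_part_def vec_eq_iff)
  have "linear (\<lambda>v. ((1/2) * (A_mat \<alpha> *v hor_part v) $ a) *\<^sub>R (axis None 1 :: 'a pt))"
    by (rule linearI)
      (simp_all add: hor_part matrix_vector_right_distrib matrix_vector_mult_scaleR
        scaleR_add_left add_divide_distrib)
  then have "((\<lambda>v. ((1/2) * (A_mat \<alpha> *v hor_part v) $ a) *\<^sub>R (axis None 1 :: 'a pt)) has_derivative
      (\<lambda>v. ((1/2) * (A_mat \<alpha> *v hor_part v) $ a) *\<^sub>R axis None 1)) (at p)"
    by (simp add: linear_imp_has_derivative)
  from has_derivative_diff[OF has_derivative_const this, of "axis (Some a) 1"]
  show ?thesis by (simp add: frame_def[abs_def])
qed

text \<open>The derivative takes values along the z-axis, so only the diagonal entry at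
  \<open>None\<close> could be nonzero. That entry vanishes because the z-direction has no
  horizontal part.\<close>

lemma trace_derivative_frame:
  fixes \<alpha> :: "'d::finite \<Rightarrow> real"
  shows "trace (matrix (frechet_derivative (frame \<alpha> a) (at p))) = 0"
proof -
  have "hor_part (axis None 1 :: 'd pt) = 0"
    by (simp add: hor_part_def axis_def vec_eq_iff)
  then have "A_mat \<alpha> *v hor_part (axis None 1) = 0" by simp
  then have "(- ((1/2) * (A_mat \<alpha> *v hor_part (axis k 1)) $ a) *\<^sub>R (axis None 1 :: 'd pt)) $ k = 0" for k
    by (cases k) (simp, simp add: axis_def)
  then show ?thesis
    by (simp only: trace_matrix frechet_derivative_at[OF frame_has_derivative, symmetric]
        sum.neutral_const)
qed

section \<open>The limit operator\<close>

text \<open>Every integrand is nonnegative. The bound makes \<open>sqrt\<close> of a coefficient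
  square back to the coefficient.\<close>

lemma sigma_coeff_nonneg:
  assumes "0 \<le> c"
  shows "0 \<le> sigma_coeff \<alpha> c i"
  unfolding sigma_coeff_def using assms
  by (intro mult_nonneg_nonneg divide_nonneg_nonneg sum_nonneg Bochner_Integration.integral_nonneg) auto

lemma sum_hor:
  fixes f :: "'d::finite hor \<Rightarrow> 'a::comm_monoid_add"
  shows "(\<Sum>a\<in>UNIV. f a) = (\<Sum>i\<in>UNIV. f (i, 1) + f (i, 2))"
  using sum.cartesian_product[of "\<lambda>i j. f (i, j)" "UNIV :: 2 set" UNIV]
  by (simp add: sum_2)

text \<open>Constant multiples of frame fields have trace-free derivatives. In the Leibniz rule each
  summand of the gradient therefore contributes only the second derivative along \<open>X a\<close>,
  and the weight \<open>exp h\<close> adds the first-order product.\<close>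

lemma divergence_gradient_frame:
  fixes \<alpha> :: "'d::finite \<Rightarrow> real" and h \<phi> :: "'d pt \<Rightarrow> real"
  assumes \<alpha>: "\<And>i. 0 < \<alpha> i" and h: "smooth h" and \<phi>: "smooth \<phi>"
    and X: "\<And>a. smooth (X a)" and frame: "\<And>a. X a = (\<lambda>p. s a *\<^sub>R frame \<alpha> a p)"
  shows "divergence (weighted_volume \<alpha> h) (\<lambda>p. \<Sum>a\<in>UNIV. derivation (X a) \<phi> p *\<^sub>R X a p) p =
    (\<Sum>a\<in>UNIV. derivation (X a) \<phi> p * derivation (X a) h p + derivation (X a) (derivation (X a) \<phi>) p)"
proof -
  let ?K = "1 / (2 * (\<Sum>i\<in>UNIV. (\<alpha> i)\<^sup>2))"
  \<comment> \<open>Strict positivity uses that the index type of the blocks is nonempty, that is, d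
    is at least 1.\<close>
  have "0 < (\<Sum>i\<in>UNIV. (\<alpha> i)\<^sup>2)"
    using \<alpha> by (intro sum_pos) (auto simp: less_imp_neq[symmetric])
  then have K: "?K \<noteq> 0" by simp
  have \<omega>: "weighted_volume \<alpha> h = (\<lambda>p v. exp (h p) * (?K * det v))"
    by (intro ext) (simp add: weighted_volume_def popp_volume_def)
  note smooths = smooth_differentiable smooth_scaleR smooth_derivation X \<phi> h
  have fr: "frame \<alpha> a differentiable (at p)" for a p
    using frame_has_derivative by (rule differentiableI)
  have "trace (matrix (frechet_derivative (X a) (at p))) = 0" for a p
    using trace_derivative_scaleR[of "\<lambda>_. s a", OF _ fr, of p a]
    by (simp add: frame trace_derivative_frame derivation_def)
  then have "trace (matrix (frechet_derivative (\<lambda>p. \<Sum>a\<in>UNIV. derivation (X a) \<phi> p *\<^sub>R X a p) (at p))) =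
      (\<Sum>a\<in>UNIV. derivation (X a) (derivation (X a) \<phi>) p)"
    by (simp add: trace_derivative_sum trace_derivative_scaleR smooths)
  then show ?thesis
    unfolding \<omega>
    by (subst divergence_density[OF _ _ K])
      (simp_all add: smooths smooth_sum derivation_sum_left derivation_scaleR_left sum.distrib)
qed

theorem corollary15:
  fixes \<alpha> :: "'d::{finite,linorder} \<Rightarrow> real"
    and \<Delta> :: "'d pt \<Rightarrow> 'd pt set"
    and g g' :: "'d pt \<Rightarrow> 'd pt \<Rightarrow> 'd pt \<Rightarrow> real"
    and h :: "'d pt \<Rightarrow> real"
    and c :: real
  assumes "contact_carnot_group \<alpha> \<Delta> g"
    and "smooth h"
    and "0 < c" and "c \<le> 1"
    and "sub_riemannian_metric \<Delta> g'"
    and "orthonormal_frame \<Delta> g' (scaled_frame \<alpha> c)"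
  shows "(\<forall>\<phi>. smooth \<phi> \<longrightarrow>
            limit_operator \<alpha> h c \<phi> =
              (\<lambda>p. (divergence (weighted_volume \<alpha> h) \<circ> horizontal_gradient \<Delta> g') \<phi> p +
                   (2 * c - 1) * derivation (horizontal_gradient \<Delta> g' h) \<phi> p)) \<and>
         horizontal_gradient \<Delta> g' h =
           (\<lambda>p. \<Sum>a\<in>UNIV. derivation (scaled_frame \<alpha> c a) h p *\<^sub>R scaled_frame \<alpha> c a p)"
proof (intro conjI allI impI ext)
  note grad = horizontal_gradient_eq[OF assms(5,6)]
  show "horizontal_gradient \<Delta> g' h p =
      (\<Sum>a\<in>UNIV. derivation (scaled_frame \<alpha> c a) h p *\<^sub>R scaled_frame \<alpha> c a p)" for p
    by (simp add: grad assms(2))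
  fix \<phi> :: "'d pt \<Rightarrow> real" and p
  assume \<phi>: "smooth \<phi>"
  let ?X = "frame \<alpha>" and ?X' = "scaled_frame \<alpha> c"
  define \<sigma> where "\<sigma> a = sigma_coeff \<alpha> c (fst a)" for a :: "'d hor"
  have \<sigma>: "sqrt (\<sigma> a) * sqrt (\<sigma> a) = \<sigma> a" for a
    using sigma_coeff_nonneg[of c \<alpha> "fst a"] assms(3) by (simp add: \<sigma>_def)
  have \<alpha>: "0 < \<alpha> i" and smooth_X: "smooth (?X a)" for i a
    using assms(1) unfolding contact_carnot_group_def orthonormal_frame_def horizontal_section_def
    by blast+
  have smooth_X': "smooth (?X' a)" for a
    using assms(6) unfolding orthonormal_frame_def horizontal_section_def by blast
  have X'_frame: "?X' a = (\<lambda>p. sqrt (\<sigma> a) *\<^sub>R ?X a p)" for a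
    by (rule ext) (simp add: scaled_frame_def \<sigma>_def)
  have X': "derivation (?X' a) f = (\<lambda>p. sqrt (\<sigma> a) * derivation (?X a) f p)" if "smooth f" for a f
    by (rule ext) (simp add: X'_frame derivation_scaleR_left smooth_differentiable that)
  \<comment> \<open>The outer derivation is rewritten first. The factor from the inner one is
    constant in the base point and passes through, so the two square roots multiply to
    \<open>\<sigma> a\<close>.\<close>
  have X'X': "derivation (?X' a) (derivation (?X' a) \<phi>) p =
      \<sigma> a * derivation (?X a) (derivation (?X a) \<phi>) p" for a
  proof -
    have "derivation (?X' a) (derivation (?X' a) \<phi>) p =
        sqrt (\<sigma> a) * (sqrt (\<sigma> a) * derivation (?X a) (derivation (?X a) \<phi>) p)"
      using smooth_derivation[OF smooth_X \<phi>] smooth_derivation[OF smooth_X' \<phi>]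
      by (simp only: X'[OF smooth_derivation[OF smooth_X' \<phi>]])
        (simp only: X'[OF \<phi>] derivation_mult_const smooth_differentiable)
    then show ?thesis by (simp only: mult.assoc[symmetric] \<sigma>)
  qed
  have sq: "derivation (?X' a) f p * derivation (?X' a) f' p =
      \<sigma> a * (derivation (?X a) f p * derivation (?X a) f' p)" if "smooth f" "smooth f'" for a f f'
  proof -
    have "derivation (?X' a) f p * derivation (?X' a) f' p =
        (sqrt (\<sigma> a) * sqrt (\<sigma> a)) * (derivation (?X a) f p * derivation (?X a) f' p)"
      by (simp only: X'[OF that(1)] X'[OF that(2)] mult_ac)
    then show ?thesis by (simp only: \<sigma>)
  qed
  \<comment> \<open>The two terms of each block merge into one sum over all horizontal indices,
    since \<open>\<sigma>\<close> depends only on the block.\<close>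
  have "limit_operator \<alpha> h c \<phi> p =
      (\<Sum>a\<in>UNIV. \<sigma> a * derivation (?X a) (derivation (?X a) \<phi>) p) +
      2 * c * (\<Sum>a\<in>UNIV. \<sigma> a * (derivation (?X a) h p * derivation (?X a) \<phi> p))"
    by (simp add: limit_operator_def sum_hor \<sigma>_def distrib_left)
  also have "\<dots> = (\<Sum>a\<in>UNIV. derivation (?X' a) (derivation (?X' a) \<phi>) p) +
      2 * c * (\<Sum>a\<in>UNIV. derivation (?X' a) h p * derivation (?X' a) \<phi> p)"
    by (simp add: X'X' sq \<phi> assms(2))
  also have "\<dots> = (divergence (weighted_volume \<alpha> h) \<circ> horizontal_gradient \<Delta> g') \<phi> p +
      (2 * c - 1) * derivation (horizontal_gradient \<Delta> g' h) \<phi> p"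
    \<comment> \<open>The divergence absorbs one of the \<open>2 * c\<close> copies of the
      first-order sum.\<close>
    using divergence_gradient_frame[OF \<alpha> assms(2) \<phi> smooth_X' X'_frame, of p]
    by (simp add: grad assms(2) \<phi> derivation_sum_left derivation_scaleR_left smooth_differentiable
        sum.distrib algebra_simps)
  finally show "limit_operator \<alpha> h c \<phi> p =
      (divergence (weighted_volume \<alpha> h) \<circ> horizontal_gradient \<Delta> g') \<phi> p +
      (2 * c - 1) * derivation (horizontal_gradient \<Delta> g' h) \<phi> p" .
qed

end
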